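(* For each unit vector $\mathbf n\in S^2\subset\mathbb R^3$, the 4-dimensional submanifold $$\mathcal M(\mathbf n)=\{(\mathbf u,\mathbf v)\in\mathcal M:\ \mathbf u\cdot\mathbf n=0=\mathbf v\cdot\mathbf n,\ uv\ne0\}$$ is $\mathbb J$-holomorphic, i.e. its tangent spaces are $\mathbb J$-invariant.
   Context: Let $x_0,\dots,x_7$ be the standard coordinates on $\mathbb R^8$, with partial derivatives $\partial_i$, and let $e=\sum_i dx_i\otimes dx_i$ and $R=\sum_i x_i^2$. Put $X=-x_1\partial_0+x_0\partial_1-x_3\partial_2+x_2\partial_3-x_5\partial_4+x_4\partial_5-x_7\partial_6+x_6\partial_7$, $Y_1=-x_1\partial_0+x_0\partial_1+x_3\partial_2-x_2\partial_3-x_5\partial_4+x_4\partial_5+x_7\partial_6-x_6\partial_7$, $Y_2=-x_2\partial_0+x_0\partial_2+x_1\partial_3-x_3\partial_1-x_6\partial_4+x_4\partial_6+x_5\partial_7-x_7\partial_5$, $Y_3=-x_3\partial_0+x_0\partial_3+x_2\partial_1-x_1\partial_2-x_7\partial_4+x_4\partial_7+x_6\partial_5-x_5\partial_6$, $\alpha_i=e(Y_i,\cdot)$ and $\hat\alpha_i=\alpha_i/R$. The flow of $Y_1$ is a free circle action on $\mathbb R^8\setminus0$ with quotient $\mathcal C=\mathbb R^+\times\mathbb{CP}^3$; tensors on $\mathcal C$ are identified with their pullbacks to $\mathbb R^8\setminus 0$. The conical $G_2$ structure on $\mathcal C$ has 3-form $\varphi=d(\tfrac13R^3\omega)$, $\omega=d\hat\alpha_1+3\hat\alpha_2\wedge\hat\alpha_3$,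 and metric $h_2=\tfrac12dR^2+2R\,e-2\alpha_1^2-\alpha_2^2-\alpha_3^2$. The vector field $X$ generates a circle action on $\mathcal C$; its quotient is $Q:\mathcal C\to\mathcal M\cong\mathbb R^6\setminus0$, with coordinates $(\mathbf u,\mathbf v)=(u_1,u_2,u_3;v_1,v_2,v_3)$ given by $u_1=x_0^2+x_1^2-x_4^2-x_5^2$, $u_2=2(x_0x_4+x_1x_5)$, $u_3=2(x_0x_5-x_1x_4)$, $v_1=x_2^2+x_3^2-x_6^2-x_7^2$, $v_2=2(x_2x_6+x_3x_7)$, $v_3=2(x_2x_7-x_3x_6)$. Also $u=|\mathbf u|$, $v=|\mathbf v|$, $R=u+v$. Let $N=h_2(X,X)=6uv-2\,\mathbf u\cdot\mathbf v$ and $\Theta_2=\frac2Nh_2(X,\cdot)$. On the locus $uv\ne0$ of $\mathcal M$: the metric $g_2$ is determined by $h_2=Q^*g_2+\tfrac14N\,\Theta_2\otimes\Theta_2$; the symplectic form $\sigma$ is the 2-form to which $X\lrcorner\varphi$ descends; and the almost complex structure $\mathbb J$ is determined by $\sigma(W,Y)=N^{1/2}g_2(\mathbb JW,Y)$ for all tangent vectors $W,Y$. *)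

theory Defs
  imports "HOL-Analysis.Analysis"
begin

section \<open>Smooth maps, submanifolds, tangent spaces\<close>

text \<open>For open \<open>S\<close>. The Suc case asks every directional derivative to be of class \<open>C\<^sup>k\<close>.\<close>

primrec Ck_on :: "nat \<Rightarrow> 'a::euclidean_space set \<Rightarrow> ('a \<Rightarrow> 'b::euclidean_space) \<Rightarrow> bool" where
  "Ck_on 0 S f \<longleftrightarrow> continuous_on S f"
| "Ck_on (Suc k) S f \<longleftrightarrow>
     (\<forall>x\<in>S. f differentiable (at x)) \<and> (\<forall>v. Ck_on k S (\<lambda>x. frechet_derivative f (at x) v))"

definition smooth_on :: "'a::euclidean_space set \<Rightarrow> ('a \<Rightarrow> 'b::euclidean_space) \<Rightarrow> bool" where
  "smooth_on S f \<longleftrightarrow> (\<forall>k. Ck_on k S f)"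

definition embedded_submanifold :: "nat \<Rightarrow> 'a::euclidean_space set \<Rightarrow> bool" where
  "embedded_submanifold k S \<longleftrightarrow>
     (\<forall>p\<in>S. \<exists>U V f g (L::'a set).
        open U \<and> p \<in> U \<and> open V \<and> subspace L \<and> dim L = k \<and>
        homeomorphism U V f g \<and> smooth_on U f \<and> smooth_on V g \<and>
        f ` (S \<inter> U) = V \<inter> L)"

text \<open>Velocities at \<open>p\<close> of smooth curves lying in \<open>S\<close>.\<close>

definition tangent_space :: "'a::euclidean_space set \<Rightarrow> 'a \<Rightarrow> 'a set" where
  "tangent_space S p =
     {w. \<exists>\<gamma> \<epsilon>::real. 0 < \<epsilon> \<and> smooth_on {-\<epsilon><..<\<epsilon>} \<gamma> \<and> \<gamma> ` {-\<epsilon><..<\<epsilon>} \<subseteq> S \<and>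
            \<gamma> 0 = p \<and> (\<gamma> has_vector_derivative w) (at 0)}"

section \<open>Differential forms on Euclidean space\<close>

text \<open>A \<open>k\<close>-form takes a base point and then \<open>k\<close> tangent vectors. Wedge products and exterior
  derivatives carry no factor \<open>1/k!\<close>, so that \<open>(dx \<and> dy)(\<partial>\<^sub>x, \<partial>\<^sub>y) = 1\<close>. The exterior
  derivatives are the invariant formula evaluated on constant vector fields.\<close>

type_synonym 'a form1 = "'a \<Rightarrow> 'a \<Rightarrow> real"
type_synonym 'a form2 = "'a \<Rightarrow> 'a \<Rightarrow> 'a \<Rightarrow> real"
type_synonym 'a form3 = "'a \<Rightarrow> 'a \<Rightarrow> 'a \<Rightarrow> 'a \<Rightarrow> real"

definition d0 :: "('a::euclidean_space \<Rightarrow> real) \<Rightarrow> 'a form1" where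
  "d0 f x a = frechet_derivative f (at x) a"

definition d1 :: "'a::euclidean_space form1 \<Rightarrow> 'a form2" where
  "d1 \<alpha> x a b = d0 (\<lambda>y. \<alpha> y b) x a - d0 (\<lambda>y. \<alpha> y a) x b"

definition d2 :: "'a::euclidean_space form2 \<Rightarrow> 'a form3" where
  "d2 \<beta> x a b c = d0 (\<lambda>y. \<beta> y b c) x a - d0 (\<lambda>y. \<beta> y a c) x b + d0 (\<lambda>y. \<beta> y a b) x c"

definition wedge11 :: "'a form1 \<Rightarrow> 'a form1 \<Rightarrow> 'a form2" where
  "wedge11 \<alpha> \<beta> x a b = \<alpha> x a * \<beta> x b - \<alpha> x b * \<beta> x a"

section \<open>Vector fields and tensors on \<open>\<real>\<^sup>8\<close>\<close>

text \<open>The index type \<open>8\<close> has the elements \<open>0, \<dots>, 7\<close>, so \<open>x $ i\<close> is the coordinate \<open>x\<^sub>i\<close>.\<close>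

definition pd :: "8 \<Rightarrow> real^8" where
  "pd i = axis i 1"

definition X :: "real^8 \<Rightarrow> real^8" where
  "X x = - x$1 *\<^sub>R pd 0 + x$0 *\<^sub>R pd 1 - x$3 *\<^sub>R pd 2 + x$2 *\<^sub>R pd 3
         - x$5 *\<^sub>R pd 4 + x$4 *\<^sub>R pd 5 - x$7 *\<^sub>R pd 6 + x$6 *\<^sub>R pd 7"

definition Y1 :: "real^8 \<Rightarrow> real^8" where
  "Y1 x = - x$1 *\<^sub>R pd 0 + x$0 *\<^sub>R pd 1 + x$3 *\<^sub>R pd 2 - x$2 *\<^sub>R pd 3
          - x$5 *\<^sub>R pd 4 + x$4 *\<^sub>R pd 5 + x$7 *\<^sub>R pd 6 - x$6 *\<^sub>R pd 7"

definition Y2 :: "real^8 \<Rightarrow> real^8" where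
  "Y2 x = - x$2 *\<^sub>R pd 0 + x$0 *\<^sub>R pd 2 + x$1 *\<^sub>R pd 3 - x$3 *\<^sub>R pd 1
          - x$6 *\<^sub>R pd 4 + x$4 *\<^sub>R pd 6 + x$5 *\<^sub>R pd 7 - x$7 *\<^sub>R pd 5"

definition Y3 :: "real^8 \<Rightarrow> real^8" where
  "Y3 x = - x$3 *\<^sub>R pd 0 + x$0 *\<^sub>R pd 3 + x$2 *\<^sub>R pd 1 - x$1 *\<^sub>R pd 2
          - x$7 *\<^sub>R pd 4 + x$4 *\<^sub>R pd 7 + x$6 *\<^sub>R pd 5 - x$5 *\<^sub>R pd 6"

definition R8 :: "real^8 \<Rightarrow> real" where
  "R8 x = (\<Sum>i\<in>UNIV. (x$i)\<^sup>2)"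

text \<open>The metric \<open>e\<close> is the inner product of \<open>real^8\<close>.\<close>

definition \<alpha>1 :: "(real^8) form1" where "\<alpha>1 x a = Y1 x \<bullet> a"
definition \<alpha>2 :: "(real^8) form1" where "\<alpha>2 x a = Y2 x \<bullet> a"
definition \<alpha>3 :: "(real^8) form1" where "\<alpha>3 x a = Y3 x \<bullet> a"

definition \<alpha>1_hat :: "(real^8) form1" where "\<alpha>1_hat x a = \<alpha>1 x a / R8 x"
definition \<alpha>2_hat :: "(real^8) form1" where "\<alpha>2_hat x a = \<alpha>2 x a / R8 x"
definition \<alpha>3_hat :: "(real^8) form1" where "\<alpha>3_hat x a = \<alpha>3 x a / R8 x"

text \<open>Tensors on the cone over \<open>\<complex>\<P>\<^sup>3\<close> are represented by their pullbacks to \<open>\<real>\<^sup>8 - {0}\<close>;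
  in particular \<open>h2\<close> is degenerate along \<open>Y1\<close>. The values at \<open>0\<close> are irrelevant.\<close>

definition \<omega> :: "(real^8) form2" where
  "\<omega> x a b = d1 \<alpha>1_hat x a b + 3 * wedge11 \<alpha>2_hat \<alpha>3_hat x a b"

definition \<phi> :: "(real^8) form3" where
  "\<phi> = d2 (\<lambda>x a b. 1/3 * R8 x ^ 3 * \<omega> x a b)"

definition h2 :: "real^8 \<Rightarrow> real^8 \<Rightarrow> real^8 \<Rightarrow> real" where
  "h2 x a b = 1/2 * d0 R8 x a * d0 R8 x b + 2 * R8 x * (a \<bullet> b)
      - 2 * \<alpha>1 x a * \<alpha>1 x b - \<alpha>2 x a * \<alpha>2 x b - \<alpha>3 x a * \<alpha>3 x b"

definition N :: "real^8 \<Rightarrow> real" where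
  "N x = h2 x (X x) (X x)"

definition \<Theta>2 :: "(real^8) form1" where
  "\<Theta>2 x a = 2 / N x * h2 x (X x) a"

section \<open>The quotient \<open>\<M>\<close>\<close>

type_synonym R6 = "(real^3) \<times> (real^3)"

definition Q :: "real^8 \<Rightarrow> R6" where
  "Q x =
    (vector [(x$0)\<^sup>2 + (x$1)\<^sup>2 - (x$4)\<^sup>2 - (x$5)\<^sup>2,
             2 * (x$0 * x$4 + x$1 * x$5),
             2 * (x$0 * x$5 - x$1 * x$4)],
     vector [(x$2)\<^sup>2 + (x$3)\<^sup>2 - (x$6)\<^sup>2 - (x$7)\<^sup>2,
             2 * (x$2 * x$6 + x$3 * x$7),
             2 * (x$2 * x$7 - x$3 * x$6)])"

definition dQ :: "real^8 \<Rightarrow> real^8 \<Rightarrow> R6" where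
  "dQ x = frechet_derivative Q (at x)"

definition \<M> :: "R6 set" where
  "\<M> = UNIV - {0}"

text \<open>The function on \<open>\<M>\<close> to which \<open>N\<close> descends, see \<open>N_descends\<close> below.\<close>

definition N_quot :: "R6 \<Rightarrow> real" where
  "N_quot m = 6 * norm (fst m) * norm (snd m) - 2 * (fst m \<bullet> snd m)"

text \<open>The tensors \<open>g2\<close>, \<open>\<sigma>\<close> and \<open>\<J>\<close> are meant at points \<open>m = (\<u>, \<v>)\<close> with \<open>\<u> \<noteq> 0 \<noteq> \<v>\<close>.
  The first two are described by the values of their pullbacks at all points of the fibre over
  \<open>m\<close>, so the descriptions include the fact that the tensors upstairs descend.\<close>

definition g2 :: "R6 \<Rightarrow> R6 \<Rightarrow> R6 \<Rightarrow> real" where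
  "g2 m = (THE g. \<forall>x. Q x = m \<longrightarrow>
     (\<forall>a b. h2 x a b = g (dQ x a) (dQ x b) + 1/4 * N x * (\<Theta>2 x a * \<Theta>2 x b)))"

definition \<sigma> :: "R6 form2" where
  "\<sigma> m = (THE s. \<forall>x. Q x = m \<longrightarrow> (\<forall>a b. \<phi> x (X x) a b = s (dQ x a) (dQ x b)))"

definition \<J> :: "R6 \<Rightarrow> R6 \<Rightarrow> R6" where
  "\<J> m = (THE J. linear J \<and> (\<forall>W Y. \<sigma> m W Y = N_quot m powr (1/2) * g2 m (J W) Y))"

definition M_of :: "real^3 \<Rightarrow> R6 set" where
  "M_of n = {(\<u>, \<v>). (\<u>, \<v>) \<in> \<M> \<and> \<u> \<bullet> n = 0 \<and> 0 = \<v> \<bullet> n \<and> norm \<u> * norm \<v> \<noteq> 0}"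

section \<open>Consistency of the coordinates\<close>

lemma UNIV_8: "(UNIV :: 8 set) = {0,1,2,3,4,5,6,7}"
proof -
  have "card {0,1,2,3,4,5,6,7::8} = 8" by simp
  then show ?thesis
    by (intro sym[OF card_subset_eq]) (simp_all add: card_num1)
qed

lemma norm_Q:
  "norm (fst (Q x)) = (x$0)\<^sup>2 + (x$1)\<^sup>2 + (x$4)\<^sup>2 + (x$5)\<^sup>2"
  "norm (snd (Q x)) = (x$2)\<^sup>2 + (x$3)\<^sup>2 + (x$6)\<^sup>2 + (x$7)\<^sup>2"
  unfolding norm_eq_sqrt_inner
  by (intro real_sqrt_unique;
      simp add: Q_def inner_vec_def sum_3 vector_3 power2_eq_square algebra_simps)+

lemma R8_eq: "R8 x = norm (fst (Q x)) + norm (snd (Q x))"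
  unfolding norm_Q R8_def UNIV_8 by simp

lemma X_nth:
  "X x $ 0 = - x$1" "X x $ 1 = x$0" "X x $ 2 = - x$3" "X x $ 3 = x$2"
  "X x $ 4 = - x$5" "X x $ 5 = x$4" "X x $ 6 = - x$7" "X x $ 7 = x$6"
  by (simp_all add: X_def pd_def axis_def)

lemma Y_nth:
  "Y1 x $ 0 = - x$1" "Y1 x $ 1 = x$0" "Y1 x $ 2 = x$3" "Y1 x $ 3 = - x$2"
  "Y1 x $ 4 = - x$5" "Y1 x $ 5 = x$4" "Y1 x $ 6 = x$7" "Y1 x $ 7 = - x$6"
  "Y2 x $ 0 = - x$2" "Y2 x $ 1 = - x$3" "Y2 x $ 2 = x$0" "Y2 x $ 3 = x$1"
  "Y2 x $ 4 = - x$6" "Y2 x $ 5 = - x$7" "Y2 x $ 6 = x$4" "Y2 x $ 7 = x$5"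
  "Y3 x $ 0 = - x$3" "Y3 x $ 1 = x$2" "Y3 x $ 2 = - x$1" "Y3 x $ 3 = x$0"
  "Y3 x $ 4 = - x$7" "Y3 x $ 5 = x$6" "Y3 x $ 6 = - x$5" "Y3 x $ 7 = x$4"
  by (simp_all add: Y1_def Y2_def Y3_def pd_def axis_def)

lemma R8_inner: "R8 x = x \<bullet> x"
  by (simp add: R8_def inner_vec_def power2_eq_square)

lemma d0_R8: "d0 R8 x a = 2 * (x \<bullet> a)"
proof -
  have "((\<lambda>x. x \<bullet> x) has_derivative (\<lambda>a. 2 * (x \<bullet> a))) (at x)"
    by (auto intro!: derivative_eq_intros simp: inner_commute)
  then have "(R8 has_derivative (\<lambda>a. 2 * (x \<bullet> a))) (at x)"
    by (simp add: R8_inner[abs_def])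
  then show ?thesis
    unfolding d0_def by (metis frechet_derivative_at)
qed

lemma inner_8:
  "(a::real^8) \<bullet> b = a$0 * b$0 + a$1 * b$1 + a$2 * b$2 + a$3 * b$3
                     + a$4 * b$4 + a$5 * b$5 + a$6 * b$6 + a$7 * b$7"
  unfolding inner_vec_def UNIV_8 by simp

lemma N_descends: "N x = N_quot (Q x)"
proof -
  define u where "u = norm (fst (Q x))"
  define v where "v = norm (snd (Q x))"
  define w where "w = fst (Q x) \<bullet> snd (Q x)"
  have xX: "x \<bullet> X x = 0"
    unfolding inner_8 X_nth by algebra
  have XX: "X x \<bullet> X x = u + v"
    unfolding u_def v_def norm_Q inner_8 X_nth by algebra
  have R: "R8 x = u + v"
    unfolding u_def v_def by (rule R8_eq)
  have a1: "\<alpha>1 x (X x) = u - v"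
    unfolding u_def v_def norm_Q \<alpha>1_def inner_8 X_nth Y_nth by algebra
  have a2: "\<alpha>2 x (X x) = 2 * (x$1 * x$2 - x$0 * x$3 + x$5 * x$6 - x$4 * x$7)"
    unfolding \<alpha>2_def inner_8 X_nth Y_nth by algebra
  have a3: "\<alpha>3 x (X x) = 2 * (x$1 * x$3 + x$0 * x$2 + x$5 * x$7 + x$4 * x$6)"
    unfolding \<alpha>3_def inner_8 X_nth Y_nth by algebra
  have w: "w =
      ((x$0)\<^sup>2 + (x$1)\<^sup>2 - (x$4)\<^sup>2 - (x$5)\<^sup>2) * ((x$2)\<^sup>2 + (x$3)\<^sup>2 - (x$6)\<^sup>2 - (x$7)\<^sup>2)
      + 2 * (x$0 * x$4 + x$1 * x$5) * (2 * (x$2 * x$6 + x$3 * x$7))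
      + 2 * (x$0 * x$5 - x$1 * x$4) * (2 * (x$2 * x$7 - x$3 * x$6))"
    unfolding w_def
    by (simp only: Q_def inner_vec_def sum_3 vector_3 fst_conv snd_conv inner_real_def)
  have a23: "(\<alpha>2 x (X x))\<^sup>2 + (\<alpha>3 x (X x))\<^sup>2 = 2 * u * v + 2 * w"
    unfolding a2 a3 u_def v_def norm_Q w by algebra
  have "N x = 2 * (u + v)\<^sup>2 - 2 * (u - v)\<^sup>2 - ((\<alpha>2 x (X x))\<^sup>2 + (\<alpha>3 x (X x))\<^sup>2)"
    unfolding N_def h2_def d0_R8 xX XX R a1 power2_eq_square by (simp add: algebra_simps)
  also have "\<dots> = 6 * u * v - 2 * w"
    unfolding a23 by algebra
  finally show ?thesis
    unfolding N_quot_def u_def v_def w_def .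
qed

end

theory Submission
  imports Defs
begin

text \<open>The explicit expressions \<open>g_expl\<close> and \<open>\<sigma>_expl\<close> for \<open>g2\<close> and \<open>\<sigma>\<close> in terms of
  \<open>(\<u>, \<v>)\<close> involve only inner products and a product of two triple products
  \<open>det(\<u>, \<v>, \<cdot>)\<close>. The latter vanish on vectors orthogonal to \<open>\<n>\<close> once
  \<open>\<u>\<close> and \<open>\<v>\<close> are. Hence along \<open>\<M>(\<n>)\<close> the tangent space
  \<open>L = \<n>\<^sup>\<perp> \<oplus> \<n>\<^sup>\<perp>\<close> and its complement \<open>(\<real>\<n>) \<oplus> (\<real>\<n>)\<close> are
  orthogonal for both tensors, and as \<open>g2\<close> is positive definite, \<open>\<J>\<close> preserves \<open>L\<close>.\<close>

section \<open>Adapted coordinates on the fibres of \<open>Q\<close>\<close>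

definition dQ_poly :: "real^8 \<Rightarrow> real^8 \<Rightarrow> R6" where
  "dQ_poly x a =
    (vector [2 * (x$0 * a$0 + x$1 * a$1 - x$4 * a$4 - x$5 * a$5),
             2 * (x$0 * a$4 + a$0 * x$4 + x$1 * a$5 + a$1 * x$5),
             2 * (x$0 * a$5 + a$0 * x$5 - x$1 * a$4 - a$1 * x$4)],
     vector [2 * (x$2 * a$2 + x$3 * a$3 - x$6 * a$6 - x$7 * a$7),
             2 * (x$2 * a$6 + a$2 * x$6 + x$3 * a$7 + a$3 * x$7),
             2 * (x$2 * a$7 + a$2 * x$7 - x$3 * a$6 - a$3 * x$6)])"

lemma has_derivative_vec_nth [derivative_intros]:
  "((\<lambda>x. x $ i) has_derivative (\<lambda>a. a $ i)) (at (x::real^'n))"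
  by (rule bounded_linear_imp_has_derivative) (rule bounded_linear_vec_nth)

lemma has_derivative_real3:
  fixes f f' :: "'a::real_normed_vector \<Rightarrow> real^3"
  assumes "((\<lambda>x. f x $ 1) has_derivative (\<lambda>a. f' a $ 1)) (at x)"
    and "((\<lambda>x. f x $ 2) has_derivative (\<lambda>a. f' a $ 2)) (at x)"
    and "((\<lambda>x. f x $ 3) has_derivative (\<lambda>a. f' a $ 3)) (at x)"
  shows "(f has_derivative f') (at x)"
proof -
  have "((\<lambda>x. f x $ i) has_derivative (\<lambda>a. f' a $ i)) (at x)" for i
    using assms exhaust_3[of i] by auto
  then show ?thesis
    unfolding has_derivative_componentwise_within[of f] by (auto simp: Basis_vec_def inner_axis)
qed

lemma dQ_eq: "dQ x a = dQ_poly x a"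
proof -
  have "((\<lambda>x. fst (Q x)) has_derivative (\<lambda>a. fst (dQ_poly x a))) (at x)"
    by (rule has_derivative_real3)
      (auto simp: Q_def dQ_poly_def power2_eq_square algebra_simps intro!: derivative_eq_intros)
  moreover have "((\<lambda>x. snd (Q x)) has_derivative (\<lambda>a. snd (dQ_poly x a))) (at x)"
    by (rule has_derivative_real3)
      (auto simp: Q_def dQ_poly_def power2_eq_square algebra_simps intro!: derivative_eq_intros)
  ultimately have "(Q has_derivative dQ_poly x) (at x)"
    using has_derivative_Pair by fastforce
  then show ?thesis
    unfolding dQ_def by (metis frechet_derivative_at)
qed

text \<open>Write \<open>\<real>\<^sup>8 = \<complex>\<^sup>2 \<oplus> \<complex>\<^sup>2\<close> with \<open>z = (x\<^sub>0 + i x\<^sub>1, x\<^sub>4 + i x\<^sub>5)\<close> and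
  \<open>w = (x\<^sub>2 + i x\<^sub>3, x\<^sub>6 + i x\<^sub>7)\<close>, so that \<open>Q\<close> is a pair of Hopf maps. With \<open>\<tau>\<close> the vector of
  Pauli matrices, \<open>lift x U V p q\<close> is the tangent vector \<open>((U \<bullet> \<tau> + i p) z, (V \<bullet> \<tau> + i q) w)\<close>.\<close>

definition lift :: "real^8 \<Rightarrow> real^3 \<Rightarrow> real^3 \<Rightarrow> real \<Rightarrow> real \<Rightarrow> real^8" where
  "lift x U V p q =
     (U$1 * x$0 + U$2 * x$4 + U$3 * x$5 - p * x$1) *\<^sub>R pd 0
   + (U$1 * x$1 + U$2 * x$5 - U$3 * x$4 + p * x$0) *\<^sub>R pd 1
   + (V$1 * x$2 + V$2 * x$6 + V$3 * x$7 - q * x$3) *\<^sub>R pd 2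
   + (V$1 * x$3 + V$2 * x$7 - V$3 * x$6 + q * x$2) *\<^sub>R pd 3
   + (U$2 * x$0 - U$3 * x$1 - U$1 * x$4 - p * x$5) *\<^sub>R pd 4
   + (U$2 * x$1 + U$3 * x$0 - U$1 * x$5 + p * x$4) *\<^sub>R pd 5
   + (V$2 * x$2 - V$3 * x$3 - V$1 * x$6 - q * x$7) *\<^sub>R pd 6
   + (V$2 * x$3 + V$3 * x$2 - V$1 * x$7 + q * x$6) *\<^sub>R pd 7"

lemma lift_nth:
  "lift x U V p q $ 0 = U$1 * x$0 + U$2 * x$4 + U$3 * x$5 - p * x$1"
  "lift x U V p q $ 1 = U$1 * x$1 + U$2 * x$5 - U$3 * x$4 + p * x$0"
  "lift x U V p q $ 2 = V$1 * x$2 + V$2 * x$6 + V$3 * x$7 - q * x$3"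
  "lift x U V p q $ 3 = V$1 * x$3 + V$2 * x$7 - V$3 * x$6 + q * x$2"
  "lift x U V p q $ 4 = U$2 * x$0 - U$3 * x$1 - U$1 * x$4 - p * x$5"
  "lift x U V p q $ 5 = U$2 * x$1 + U$3 * x$0 - U$1 * x$5 + p * x$4"
  "lift x U V p q $ 6 = V$2 * x$2 - V$3 * x$3 - V$1 * x$6 - q * x$7"
  "lift x U V p q $ 7 = V$2 * x$3 + V$3 * x$2 - V$1 * x$7 + q * x$6"
  by (simp_all add: lift_def pd_def axis_def)

lemma vec_eq_8: "(a::real^8) = b \<longleftrightarrow> a$0 = b$0 \<and> a$1 = b$1 \<and> a$2 = b$2 \<and> a$3 = b$3 \<and>
    a$4 = b$4 \<and> a$5 = b$5 \<and> a$6 = b$6 \<and> a$7 = b$7"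
proof -
  have "a = b \<longleftrightarrow> (\<forall>i\<in>UNIV. a$i = b$i)"
    by (simp add: vec_eq_iff)
  then show ?thesis
    unfolding UNIV_8 by auto
qed

lemma vec_eq_3: "(a::real^3) = b \<longleftrightarrow> a$1 = b$1 \<and> a$2 = b$2 \<and> a$3 = b$3"
  by (simp add: vec_eq_iff forall_3)

lemma inner_3: "(a::real^3) \<bullet> b = a$1 * b$1 + a$2 * b$2 + a$3 * b$3"
  by (simp add: inner_vec_def sum_3)

lemmas Q_nth = Q_def fst_conv snd_conv vector_3

lemma lift_X: "X x = lift x 0 0 1 1" and lift_Y1: "Y1 x = lift x 0 0 1 (-1)"
  by (simp_all add: vec_eq_8 X_nth Y_nth lift_nth)

text \<open>The first half of \<open>Q\<close> is \<open>z\<^sup>* \<tau>\<^sub>k z\<close>. The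
  anticommutator of \<open>\<tau>\<^sub>k\<close> and \<open>U \<bullet> \<tau>\<close> is
  \<open>2 U\<^sub>k\<close>, which leaves the squared length of \<open>z\<close>, namely
  \<open>norm (fst (Q x))\<close>; the phase direction \<open>i z\<close> is tangent to the fibre.
  The second half is the same with \<open>w\<close>.\<close>

lemma dQ_lift:
  "dQ x (lift x U V p q) = ((2 * norm (fst (Q x))) *\<^sub>R U, (2 * norm (snd (Q x))) *\<^sub>R V)"
  unfolding dQ_eq dQ_poly_def prod_eq_iff vec_eq_3 fst_conv snd_conv vector_3 norm_Q lift_nth
    vector_scaleR_component real_scaleR_def
  by (intro conjI; algebra)

text \<open>The vectors \<open>i z\<close> and \<open>\<tau>\<^sub>k z\<close> are orthogonal over
  the reals with squared length \<open>norm (fst (Q x))\<close>, so they form a basis of the first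
  \<open>\<complex>\<^sup>2\<close>; likewise for \<open>w\<close>. The witnesses are the
  coefficients of \<open>a\<close> in these bases.\<close>

lemma ex_lift:
  assumes "fst (Q x) \<noteq> 0" "snd (Q x) \<noteq> 0"
  obtains U V p q where "a = lift x U V p q"
proof -
  define u where "u = norm (fst (Q x))"
  define v where "v = norm (snd (Q x))"
  have nz: "u \<noteq> 0" "v \<noteq> 0" using assms by (auto simp: u_def v_def)
  have c: "s = t" if "c \<noteq> 0" "c * s = c * t" for c s t :: real
    using that by simp
  define U where "U = (1/u) *\<^sub>R (1/2) *\<^sub>R fst (dQ_poly x a)"
  define V where "V = (1/v) *\<^sub>R (1/2) *\<^sub>R snd (dQ_poly x a)"
  define p where "p = (1/u) * (x$0 * a$1 - x$1 * a$0 + x$4 * a$5 - x$5 * a$4)"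
  define q where "q = (1/v) * (x$2 * a$3 - x$3 * a$2 + x$6 * a$7 - x$7 * a$6)"
  have U: "u * U$1 = x$0 * a$0 + x$1 * a$1 - x$4 * a$4 - x$5 * a$5"
    "u * U$2 = x$0 * a$4 + a$0 * x$4 + x$1 * a$5 + a$1 * x$5"
    "u * U$3 = x$0 * a$5 + a$0 * x$5 - x$1 * a$4 - a$1 * x$4"
    "u * p = x$0 * a$1 - x$1 * a$0 + x$4 * a$5 - x$5 * a$4"
    using nz by (simp_all add: U_def p_def dQ_poly_def)
  have V: "v * V$1 = x$2 * a$2 + x$3 * a$3 - x$6 * a$6 - x$7 * a$7"
    "v * V$2 = x$2 * a$6 + a$2 * x$6 + x$3 * a$7 + a$3 * x$7"
    "v * V$3 = x$2 * a$7 + a$2 * x$7 - x$3 * a$6 - a$3 * x$6"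
    "v * q = x$2 * a$3 - x$3 * a$2 + x$6 * a$7 - x$7 * a$6"
    using nz by (simp_all add: V_def q_def dQ_poly_def)
  have u: "u = (x$0)\<^sup>2 + (x$1)\<^sup>2 + (x$4)\<^sup>2 + (x$5)\<^sup>2"
    and v: "v = (x$2)\<^sup>2 + (x$3)\<^sup>2 + (x$6)\<^sup>2 + (x$7)\<^sup>2"
    by (simp_all add: u_def v_def norm_Q)
  have "u * a$0 = u * lift x U V p q $ 0" "u * a$1 = u * lift x U V p q $ 1"
    "u * a$4 = u * lift x U V p q $ 4" "u * a$5 = u * lift x U V p q $ 5"
    unfolding lift_nth using U u by algebra+
  moreover have "v * a$2 = v * lift x U V p q $ 2" "v * a$3 = v * lift x U V p q $ 3"
    "v * a$6 = v * lift x U V p q $ 6" "v * a$7 = v * lift x U V p q $ 7"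
    unfolding lift_nth using V v by algebra+
  ultimately have "a = lift x U V p q"
    using nz unfolding vec_eq_8 by (auto intro: c)
  then show thesis by (rule that)
qed

lemma h2_eq: "h2 x a b = 2 * (x \<bullet> a) * (x \<bullet> b) + 2 * R8 x * (a \<bullet> b)
      - 2 * \<alpha>1 x a * \<alpha>1 x b - (\<alpha>2 x a * \<alpha>2 x b + \<alpha>3 x a * \<alpha>3 x b)"
  unfolding h2_def d0_R8 by simp

lemma inner_lift:
  "x \<bullet> lift x U V p q = fst (Q x) \<bullet> U + snd (Q x) \<bullet> V"
  unfolding inner_8 inner_3 lift_nth Q_nth by algebra

lemma inner_lift_lift:
  "lift x U V p q \<bullet> lift x U' V' p' q' =
     norm (fst (Q x)) * (U \<bullet> U' + p * p') + norm (snd (Q x)) * (V \<bullet> V' + q * q')"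
  unfolding inner_8 inner_3 lift_nth norm_Q by algebra

lemma \<alpha>1_lift: "\<alpha>1 x (lift x U V p q) = norm (fst (Q x)) * p - norm (snd (Q x)) * q"
  unfolding \<alpha>1_def inner_8 Y_nth lift_nth norm_Q by algebra

text \<open>Here \<open>\<alpha>2 + i \<alpha>3\<close> takes the value \<open>z\<^sup>* (C \<bullet> \<tau> + i (p + q)) w\<close>. Below, \<open>r\<^sub>k + i i\<^sub>k\<close> is
  \<open>z\<^sup>* \<tau>\<^sub>k w\<close> with \<open>\<tau>\<^sub>0 = 1\<close>.\<close>

lemma \<alpha>23_lift:
  fixes x U V p q U' V' p' q'
  defines "u \<equiv> fst (Q x)" and "v \<equiv> snd (Q x)"
  defines "a \<equiv> lift x U V p q" and "b \<equiv> lift x U' V' p' q'"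
  defines "C \<equiv> V - U" and "C' \<equiv> V' - U'"
  shows "2 * (\<alpha>2 x a * \<alpha>2 x b + \<alpha>3 x a * \<alpha>3 x b) =
    (norm u * norm v - u \<bullet> v) * (C \<bullet> C') + (u \<bullet> C) * (v \<bullet> C') + (v \<bullet> C) * (u \<bullet> C')
    - (p' + q') * (cross3 u v \<bullet> C) - (p + q) * (cross3 u v \<bullet> C')
    + (p + q) * (p' + q') * (norm u * norm v + u \<bullet> v)"
proof -
  define r0 where "r0 = x$0 * x$2 + x$1 * x$3 + x$4 * x$6 + x$5 * x$7"
  define r1 where "r1 = x$0 * x$2 + x$1 * x$3 - x$4 * x$6 - x$5 * x$7"
  define r2 where "r2 = x$0 * x$6 + x$1 * x$7 + x$4 * x$2 + x$5 * x$3"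
  define r3 where "r3 = x$0 * x$7 - x$1 * x$6 - x$4 * x$3 + x$5 * x$2"
  define i0 where "i0 = x$0 * x$3 - x$1 * x$2 + x$4 * x$7 - x$5 * x$6"
  define i1 where "i1 = x$0 * x$3 - x$1 * x$2 - x$4 * x$7 + x$5 * x$6"
  define i2 where "i2 = x$0 * x$7 - x$1 * x$6 + x$4 * x$3 - x$5 * x$2"
  define i3 where "i3 = x$4 * x$2 + x$5 * x$3 - x$0 * x$6 - x$1 * x$7"
  note ri = r0_def r1_def r2_def r3_def i0_def i1_def i2_def i3_def
  define M where "M = norm u * norm v - u \<bullet> v"
  have \<alpha>2: "\<alpha>2 x (lift x U V p q) = r1 * (V$1 - U$1) + r2 * (V$2 - U$2) + r3 * (V$3 - U$3) - i0 * (p + q)"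
    and \<alpha>3: "\<alpha>3 x (lift x U V p q) = i1 * (V$1 - U$1) + i2 * (V$2 - U$2) + i3 * (V$3 - U$3) + r0 * (p + q)"
    for U V p q
    unfolding \<alpha>2_def \<alpha>3_def inner_8 Y_nth lift_nth ri by algebra+
  \<comment> \<open>With \<open>s\<^sub>k = z\<^sup>* \<tau>\<^sub>k w\<close>, the product of
    \<open>s\<^sub>j\<close> and the conjugate of \<open>s\<^sub>k\<close> is a trace in
    \<open>z z\<^sup>*\<close> and \<open>w w\<^sup>*\<close>. As
    \<open>2 z z\<^sup>* = norm u + u \<bullet> \<tau>\<close>, and similarly for \<open>w\<close>,
    such products depend only on \<open>u\<close> and \<open>v\<close>.\<close>
  have m:
    "2 * (r1 * r1 + i1 * i1) = M + 2 * (u$1 * v$1)"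
    "2 * (r2 * r2 + i2 * i2) = M + 2 * (u$2 * v$2)"
    "2 * (r3 * r3 + i3 * i3) = M + 2 * (u$3 * v$3)"
    "2 * (r1 * r2 + i1 * i2) = u$1 * v$2 + u$2 * v$1"
    "2 * (r1 * r3 + i1 * i3) = u$1 * v$3 + u$3 * v$1"
    "2 * (r2 * r3 + i2 * i3) = u$2 * v$3 + u$3 * v$2"
    "2 * (r0 * r0 + i0 * i0) = norm u * norm v + u \<bullet> v"
    "2 * (i1 * r0 - r1 * i0) = - (u$2 * v$3 - u$3 * v$2)"
    "2 * (i2 * r0 - r2 * i0) = - (u$3 * v$1 - u$1 * v$3)"
    "2 * (i3 * r0 - r3 * i0) = - (u$1 * v$2 - u$2 * v$1)"
    unfolding M_def u_def v_def inner_3 ri norm_Q unfolding Q_nth by algebra+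
  have "2 * (\<alpha>2 x a * \<alpha>2 x b + \<alpha>3 x a * \<alpha>3 x b) =
      2 * (r1 * r1 + i1 * i1) * (C$1 * C'$1) + 2 * (r2 * r2 + i2 * i2) * (C$2 * C'$2)
    + 2 * (r3 * r3 + i3 * i3) * (C$3 * C'$3) + 2 * (r1 * r2 + i1 * i2) * (C$1 * C'$2 + C$2 * C'$1)
    + 2 * (r1 * r3 + i1 * i3) * (C$1 * C'$3 + C$3 * C'$1)
    + 2 * (r2 * r3 + i2 * i3) * (C$2 * C'$3 + C$3 * C'$2)
    + 2 * (r0 * r0 + i0 * i0) * ((p + q) * (p' + q'))
    + 2 * (i1 * r0 - r1 * i0) * (C$1 * (p' + q') + C'$1 * (p + q))
    + 2 * (i2 * r0 - r2 * i0) * (C$2 * (p' + q') + C'$2 * (p + q))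
    + 2 * (i3 * r0 - r3 * i0) * (C$3 * (p' + q') + C'$3 * (p + q))"
    unfolding a_def b_def \<alpha>2 \<alpha>3 C_def C'_def vector_minus_component by algebra
  also have "\<dots> = M * (C \<bullet> C') + (u \<bullet> C) * (v \<bullet> C') + (v \<bullet> C) * (u \<bullet> C')
    - (p' + q') * (cross3 u v \<bullet> C) - (p + q) * (cross3 u v \<bullet> C')
    + (p + q) * (p' + q') * (norm u * norm v + u \<bullet> v)"
    unfolding m inner_3[of C C'] inner_3[of u C] inner_3[of v C'] inner_3[of v C] inner_3[of u C']
      inner_3[of "cross3 u v"] unfolding cross3_def vector_3 by algebra
  finally show ?thesis unfolding M_def .
qed

section \<open>The metric\<close>

text \<open>The rescaled \<open>U\<close>, \<open>V\<close> invert \<open>dQ_lift\<close>. The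
  quotient by \<open>N_quot m\<close> is what completing the square in \<open>p + q\<close> leaves
  behind when the \<open>\<Theta>2\<close> term is split off from \<open>h2\<close>.\<close>

definition g_expl :: "R6 \<Rightarrow> R6 \<Rightarrow> R6 \<Rightarrow> real" where
  "g_expl m W Y = (let u = fst m; v = snd m;
       U = (1 / (2 * norm u)) *\<^sub>R fst W; V = (1 / (2 * norm v)) *\<^sub>R snd W; C = V - U;
       U' = (1 / (2 * norm u)) *\<^sub>R fst Y; V' = (1 / (2 * norm v)) *\<^sub>R snd Y; C' = V' - U'
     in 2 * (u \<bullet> U + v \<bullet> V) * (u \<bullet> U' + v \<bullet> V')
        + 2 * (norm u + norm v) * (norm u * (U \<bullet> U') + norm v * (V \<bullet> V'))
        - ((norm u * norm v - u \<bullet> v) * (C \<bullet> C') + (u \<bullet> C) * (v \<bullet> C') + (v \<bullet> C) * (u \<bullet> C')) / 2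
        - (cross3 u v \<bullet> C) * (cross3 u v \<bullet> C') / N_quot m)"

lemma h2_X_lift:
  "h2 x (X x) (lift x U V p q) = ((p + q) * N x + 2 * (cross3 (fst (Q x)) (snd (Q x)) \<bullet> (V - U))) / 2"
  using \<alpha>23_lift[of x 0 0 1 1 U V p q]
  unfolding N_descends N_quot_def lift_X h2_eq inner_lift inner_lift_lift \<alpha>1_lift R8_eq
  by (simp add: field_simps)

lemma N_quot_pos:
  assumes "u \<noteq> 0" "v \<noteq> 0"
  shows "N_quot (u, v) > 0"
proof -
  have "u \<bullet> v \<le> norm u * norm v" by (rule norm_cauchy_schwarz)
  moreover have "norm u * norm v > 0" using assms by simp
  ultimately show ?thesis unfolding N_quot_def fst_conv snd_conv mult.assoc[of 6] by linarith
qed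

lemma h2_descends:
  assumes "fst (Q x) \<noteq> 0" "snd (Q x) \<noteq> 0"
  shows "h2 x a b = g_expl (Q x) (dQ x a) (dQ x b) + 1/4 * N x * (\<Theta>2 x a * \<Theta>2 x b)"
proof -
  obtain U V p q where a: "a = lift x U V p q" using ex_lift[OF assms] .
  obtain U' V' p' q' where b: "b = lift x U' V' p' q'" using ex_lift[OF assms] .
  define u where "u = fst (Q x)"
  define v where "v = snd (Q x)"
  define n where "n = N x"
  define C where "C = V - U"
  define C' where "C' = V' - U'"
  define D where "D = cross3 u v \<bullet> C"
  define D' where "D' = cross3 u v \<bullet> C'"
  define K where "K = (norm u * norm v - u \<bullet> v) * (C \<bullet> C') + (u \<bullet> C) * (v \<bullet> C') + (v \<bullet> C) * (u \<bullet> C')"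
  have n: "n = 6 * norm u * norm v - 2 * (u \<bullet> v)"
    unfolding n_def N_descends N_quot_def u_def v_def ..
  have n0: "n \<noteq> 0"
    using N_quot_pos[OF assms] by (simp add: n_def N_descends)
  define E where "E = D * D' / n"
  have g: "g_expl (Q x) (dQ x a) (dQ x b) = 2 * (u \<bullet> U + v \<bullet> V) * (u \<bullet> U' + v \<bullet> V')
        + 2 * (norm u + norm v) * (norm u * (U \<bullet> U') + norm v * (V \<bullet> V')) - K / 2 - E"
    unfolding g_expl_def Let_def a b dQ_lift K_def D_def D'_def E_def n_def N_descends u_def v_def C_def C'_def
    using assms by simp
  have \<alpha>23: "\<alpha>2 x a * \<alpha>2 x b + \<alpha>3 x a * \<alpha>3 x b =
      (K - (p' + q') * D - (p + q) * D' + (p + q) * (p' + q') * (norm u * norm v + u \<bullet> v)) / 2"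
    using \<alpha>23_lift[of x U V p q U' V' p' q'] by (simp add: a b u_def v_def K_def D_def D'_def C_def C'_def)
  have h: "h2 x a b = 2 * (u \<bullet> U + v \<bullet> V) * (u \<bullet> U' + v \<bullet> V')
        + 2 * (norm u + norm v) * (norm u * (U \<bullet> U' + p * p') + norm v * (V \<bullet> V' + q * q'))
        - 2 * (norm u * p - norm v * q) * (norm u * p' - norm v * q')
        - (K - (p' + q') * D - (p + q) * D' + (p + q) * (p' + q') * (norm u * norm v + u \<bullet> v)) / 2"
    unfolding h2_eq \<alpha>23 unfolding a b inner_lift inner_lift_lift \<alpha>1_lift R8_eq u_def v_def ..
  have "1/4 * N x * (\<Theta>2 x a * \<Theta>2 x b) =
      ((p + q) * n + 2 * D) * ((p' + q') * n + 2 * D') / (4 * n)"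
    unfolding \<Theta>2_def a b h2_X_lift using n0
    by (simp add: field_simps n_def u_def v_def D_def D'_def C_def C'_def)
  also have "\<dots> =
     (p + q) * (p' + q') * n / 4 + ((p + q) * D' + (p' + q') * D) / 2 + E"
    using n0 by (simp add: E_def field_simps)
  finally have t: "1/4 * N x * (\<Theta>2 x a * \<Theta>2 x b) =
     (p + q) * (p' + q') * n / 4 + ((p + q) * D' + (p' + q') * D) / 2 + E" .
  \<comment> \<open>In \<open>h\<close> the terms quadratic in \<open>p\<close>, \<open>q\<close>
    combine to \<open>(p + q) * (p' + q') * n / 4\<close>, which is the corresponding term of
    \<open>t\<close>; the difference \<open>p - q\<close>, the direction of \<open>Y1\<close>,
    cancels.\<close>
  show ?thesis
    unfolding g h t n by (simp add: field_simps)
qed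

text \<open>The vectors \<open>x, Y1 x, Y2 x, Y3 x\<close> are orthogonal of squared length \<open>R8 x\<close>, so this is the
  defect in Bessel's inequality.\<close>

lemma R8_mult_h2:
  "R8 x * h2 x a a = 2 * (norm (R8 x *\<^sub>R a - (x \<bullet> a) *\<^sub>R x
      - \<alpha>1 x a *\<^sub>R Y1 x - \<alpha>2 x a *\<^sub>R Y2 x - \<alpha>3 x a *\<^sub>R Y3 x))\<^sup>2
    + R8 x * (4 * (x \<bullet> a)\<^sup>2 + (\<alpha>2 x a)\<^sup>2 + (\<alpha>3 x a)\<^sup>2)"
proof -
  have orth: "x \<bullet> Y1 x = 0" "x \<bullet> Y2 x = 0" "x \<bullet> Y3 x = 0"
    "Y1 x \<bullet> Y2 x = 0" "Y1 x \<bullet> Y3 x = 0" "Y2 x \<bullet> Y3 x = 0"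
    "Y1 x \<bullet> x = 0" "Y2 x \<bullet> x = 0" "Y3 x \<bullet> x = 0"
    "Y2 x \<bullet> Y1 x = 0" "Y3 x \<bullet> Y1 x = 0" "Y3 x \<bullet> Y2 x = 0"
    unfolding inner_8 Y_nth by algebra+
  have norms: "x \<bullet> x = R8 x" "Y1 x \<bullet> Y1 x = R8 x" "Y2 x \<bullet> Y2 x = R8 x" "Y3 x \<bullet> Y3 x = R8 x"
    unfolding R8_inner inner_8 Y_nth by algebra+
  have a: "Y1 x \<bullet> a = \<alpha>1 x a" "Y2 x \<bullet> a = \<alpha>2 x a" "Y3 x \<bullet> a = \<alpha>3 x a"
    "a \<bullet> Y1 x = \<alpha>1 x a" "a \<bullet> Y2 x = \<alpha>2 x a" "a \<bullet> Y3 x = \<alpha>3 x a"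
    by (simp_all add: \<alpha>1_def \<alpha>2_def \<alpha>3_def inner_commute)
  show ?thesis
    unfolding h2_eq power2_norm_eq_inner
    unfolding inner_diff_left inner_diff_right inner_scaleR_left inner_scaleR_right orth norms a
      inner_commute[of a x] by algebra
qed

lemma dQ_scaleR: "dQ x (c *\<^sub>R a) = c *\<^sub>R dQ x a"
  by (simp add: dQ_eq dQ_poly_def prod_eq_iff vec_eq_3 algebra_simps)

lemma dQ_Y1: "dQ x (Y1 x) = 0"
  by (simp add: lift_Y1 dQ_lift zero_prod_def)

lemma dQ_surj:
  assumes "fst (Q x) \<noteq> 0" "snd (Q x) \<noteq> 0"
  obtains a where "dQ x a = W" "h2 x (X x) a = 0"
proof -
  define U where "U = (1 / (2 * norm (fst (Q x)))) *\<^sub>R fst W"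
  define V where "V = (1 / (2 * norm (snd (Q x)))) *\<^sub>R snd W"
  \<comment> \<open>By \<open>h2_X_lift\<close>, orthogonality to \<open>X x\<close> constrains only
    the sum of the two phases, so both are taken equal to \<open>p\<close>.\<close>
  define p where "p = - (cross3 (fst (Q x)) (snd (Q x)) \<bullet> (V - U)) / N x"
  have "N x \<noteq> 0"
    using N_quot_pos[OF assms] by (simp add: N_descends)
  then have "h2 x (X x) (lift x U V p p) = 0"
    unfolding h2_X_lift by (simp add: p_def)
  moreover have "dQ x (lift x U V p p) = W"
    using assms by (simp add: dQ_lift U_def V_def)
  ultimately show thesis by (rule that[rotated])
qed

text \<open>On a lift \<open>a\<close> of \<open>W\<close> orthogonal to \<open>X x\<close> the form
  \<open>\<Theta>2\<close> vanishes, so \<open>g_expl\<close> equals \<open>h2 x a a\<close>. If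
  this is not positive, every square in \<open>R8_mult_h2\<close> vanishes and \<open>a\<close> is a
  multiple of \<open>Y1 x\<close>, which \<open>dQ x\<close> kills.\<close>

lemma g_expl_pos:
  assumes "fst (Q x) \<noteq> 0" "snd (Q x) \<noteq> 0" "W \<noteq> 0"
  shows "g_expl (Q x) W W > 0"
proof (rule ccontr)
  assume "\<not> g_expl (Q x) W W > 0"
  obtain a where a: "dQ x a = W" "h2 x (X x) a = 0"
    using dQ_surj assms by metis
  have R: "R8 x > 0"
    using assms by (simp add: R8_eq add_pos_pos)
  have "h2 x a a \<le> 0"
    using \<open>\<not> g_expl (Q x) W W > 0\<close> h2_descends[OF assms(1,2), of a a] a by (simp add: \<Theta>2_def)
  then have "R8 x * h2 x a a \<le> 0"
    using R by (simp add: mult_le_0_iff)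
  moreover define y where "y = R8 x *\<^sub>R a - (x \<bullet> a) *\<^sub>R x
      - \<alpha>1 x a *\<^sub>R Y1 x - \<alpha>2 x a *\<^sub>R Y2 x - \<alpha>3 x a *\<^sub>R Y3 x"
  moreover have "R8 x * (4 * (x \<bullet> a)\<^sup>2 + (\<alpha>2 x a)\<^sup>2 + (\<alpha>3 x a)\<^sup>2) \<ge> 0"
    using R by simp
  ultimately have "(norm y)\<^sup>2 \<le> 0" and "R8 x * (4 * (x \<bullet> a)\<^sup>2 + (\<alpha>2 x a)\<^sup>2 + (\<alpha>3 x a)\<^sup>2) \<le> 0"
    unfolding R8_mult_h2[of x a] y_def[symmetric] using zero_le_power2[of "norm y"] by linarith+
  then have "y = 0" "4 * (x \<bullet> a)\<^sup>2 + (\<alpha>2 x a)\<^sup>2 + (\<alpha>3 x a)\<^sup>2 \<le> 0"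
    using R by (simp_all add: mult_le_0_iff)
  moreover from this(2) have "x \<bullet> a = 0" "\<alpha>2 x a = 0" "\<alpha>3 x a = 0"
    using zero_le_power2[of "x \<bullet> a"] zero_le_power2[of "\<alpha>2 x a"] zero_le_power2[of "\<alpha>3 x a"]
    by (smt (verit) power_eq_0_iff)+
  ultimately have "R8 x *\<^sub>R a = \<alpha>1 x a *\<^sub>R Y1 x"
    by (simp add: y_def)
  then have "R8 x *\<^sub>R W = 0"
    using dQ_scaleR dQ_Y1 a by (metis scaleR_zero_right)
  then show False
    using R assms by simp
qed

section \<open>Surjectivity of the Hopf maps and of \<open>Q\<close>\<close>

lemma hopf_surj:
  obtains a b c d where "u$1 = a\<^sup>2 + b\<^sup>2 - c\<^sup>2 - d\<^sup>2" "u$2 = 2 * (a * c + b * d)"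
    "(u::real^3)$3 = 2 * (a * d - b * c)"
proof -
  define r where "r = norm u"
  have r: "r\<^sup>2 = (u$1)\<^sup>2 + (u$2)\<^sup>2 + (u$3)\<^sup>2"
    unfolding r_def power2_norm_eq_inner by (simp add: inner_3 power2_eq_square)
  have "\<bar>u$1\<bar> \<le> r"
    unfolding r_def by (rule component_le_norm_cart)
  show thesis
  proof (cases "r + u$1 = 0")
    \<comment> \<open>Here \<open>u\<close> is zero or points along the negative first axis, so the
      first complex coordinate of the preimage has to vanish.\<close>
    case True
    then have "(u$2)\<^sup>2 + (u$3)\<^sup>2 = 0"
      using r by algebra
    then have "u$2 = 0" "u$3 = 0"
      by (simp_all add: sum_power2_eq_zero_iff)
    then show thesis
      using that[of 0 0 "sqrt r" 0] True by (simp add: r_def)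
  next
    case False
    \<comment> \<open>The phase is normalised by making the first complex coordinate real. Its
      square is then half the sum of the squared length \<open>r\<close> and
      \<open>u$1\<close>.\<close>
    define a where "a = sqrt ((r + u$1) / 2)"
    have a: "a\<^sup>2 = (r + u$1) / 2" "a \<noteq> 0"
      using \<open>\<bar>u$1\<bar> \<le> r\<close> False by (simp_all add: a_def)
    have "(2 * a)\<^sup>2 * (a\<^sup>2 - u$1) = (u$2)\<^sup>2 + (u$3)\<^sup>2"
      using a r by algebra
    then have "a\<^sup>2 - u$1 = ((u$2)\<^sup>2 + (u$3)\<^sup>2) / (2 * a)\<^sup>2"
      using a(2) by (simp add: eq_divide_eq mult.commute)
    then have "u$1 = a\<^sup>2 + 0\<^sup>2 - (u$2 / (2 * a))\<^sup>2 - (u$3 / (2 * a))\<^sup>2"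
      unfolding power_divide add_divide_distrib by simp
    then show thesis
      using that[of a 0 "u$2 / (2 * a)" "u$3 / (2 * a)"] a(2) by simp
  qed
qed

lemma Q_surj: obtains x where "Q x = m"
proof -
  obtain a b c d where 1: "fst m$1 = a\<^sup>2 + b\<^sup>2 - c\<^sup>2 - d\<^sup>2" "fst m$2 = 2 * (a * c + b * d)"
    "fst m$3 = 2 * (a * d - b * c)" by (rule hopf_surj)
  obtain a' b' c' d' where 2: "snd m$1 = a'\<^sup>2 + b'\<^sup>2 - c'\<^sup>2 - d'\<^sup>2" "snd m$2 = 2 * (a' * c' + b' * d')"
    "snd m$3 = 2 * (a' * d' - b' * c')" by (rule hopf_surj)
  have "Q (a *\<^sub>R pd 0 + b *\<^sub>R pd 1 + a' *\<^sub>R pd 2 + b' *\<^sub>R pd 3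
         + c *\<^sub>R pd 4 + d *\<^sub>R pd 5 + c' *\<^sub>R pd 6 + d' *\<^sub>R pd 7) = m"
    using 1 2 by (simp add: Q_def prod_eq_iff vec_eq_3 pd_def axis_def)
  then show thesis by (rule that)
qed

section \<open>The symplectic form\<close>

lemma linear_Y: "linear Y1" "linear Y2" "linear Y3"
  by (auto intro!: linearI simp: vec_eq_8 Y_nth algebra_simps)

lemma Y_skew: "Y1 a \<bullet> b = - (Y1 b \<bullet> a)" "Y2 a \<bullet> b = - (Y2 b \<bullet> a)" "Y3 a \<bullet> b = - (Y3 b \<bullet> a)"
  unfolding inner_8 Y_nth by algebra+

lemma d0_eqI: "(f has_derivative f') (at x) \<Longrightarrow> d0 f x a = f' a"
  unfolding d0_def by (metis frechet_derivative_at)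

lemma has_derivative_R8 [derivative_intros]: "(R8 has_derivative (\<lambda>a. 2 * (x \<bullet> a))) (at x)"
  unfolding R8_inner[abs_def] by (auto intro!: derivative_eq_intros simp: inner_commute)

lemma has_derivative_\<alpha> [derivative_intros]:
  "((\<lambda>y. \<alpha>1 y b) has_derivative (\<lambda>a. Y1 a \<bullet> b)) (at x)"
  "((\<lambda>y. \<alpha>2 y b) has_derivative (\<lambda>a. Y2 a \<bullet> b)) (at x)"
  "((\<lambda>y. \<alpha>3 y b) has_derivative (\<lambda>a. Y3 a \<bullet> b)) (at x)"
  unfolding \<alpha>1_def \<alpha>2_def \<alpha>3_def
  by (rule has_derivative_inner_left, rule linear_imp_has_derivative, rule linear_Y)+

lemma d1_\<alpha>1_hat:
  assumes "x \<noteq> 0"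
  shows "d1 \<alpha>1_hat x a b =
    2 * (Y1 a \<bullet> b) / R8 x - 2 * ((x \<bullet> a) * \<alpha>1 x b - (x \<bullet> b) * \<alpha>1 x a) / (R8 x)\<^sup>2"
proof -
  have R: "R8 x \<noteq> 0" using assms by (simp add: R8_inner)
  have D: "d0 (\<lambda>y. \<alpha>1_hat y b) x a = (Y1 a \<bullet> b) / R8 x - 2 * (x \<bullet> a) * \<alpha>1 x b / (R8 x)\<^sup>2" for a b
    by (rule d0_eqI) (auto simp: \<alpha>1_hat_def R power2_eq_square field_simps intro!: derivative_eq_intros)
  then show ?thesis
    unfolding d1_def D Y_skew(1)[of b a] by (simp add: diff_divide_distrib algebra_simps)
qed

text \<open>Multiplying by \<open>R\<^sup>3\<close> clears all denominators; at \<open>x = 0\<close> both sides are \<open>0\<close>.\<close>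

lemma R8_cubed_\<omega>:
  "1/3 * R8 x ^ 3 * \<omega> x a b = 1/3 * (2 * (R8 x)\<^sup>2 * (Y1 a \<bullet> b)
     - 2 * R8 x * ((x \<bullet> a) * \<alpha>1 x b - (x \<bullet> b) * \<alpha>1 x a)
     + 3 * R8 x * (\<alpha>2 x a * \<alpha>3 x b - \<alpha>2 x b * \<alpha>3 x a))"
proof (cases "x = 0")
  case True
  then show ?thesis by (simp add: R8_inner)
next
  case False
  have "1/3 * r ^ 3 * (2 * A / r - 2 * B / r\<^sup>2 + 3 * (p / r * (q / r) - s / r * (t / r)))
      = 1/3 * (2 * r\<^sup>2 * A - 2 * r * B + 3 * r * (p * q - s * t))" if "r \<noteq> 0"
    for r A B p q s t :: real
  proof -
    have "r ^ 3 * (2 * A / r - 2 * B / r\<^sup>2 + 3 * (p / r * (q / r) - s / r * (t / r)))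
      = r\<^sup>2 * (r / r) * 2 * A - 2 * r * (r / r)\<^sup>2 * B + 3 * r * (r / r)\<^sup>2 * (p * q - s * t)"
      by (simp add: power2_eq_square power3_eq_cube algebra_simps)
    then show ?thesis
      using that by simp
  qed
  moreover have "R8 x \<noteq> 0" using False by (simp add: R8_inner)
  ultimately show ?thesis
    unfolding \<omega>_def d1_\<alpha>1_hat[OF False] wedge11_def \<alpha>2_hat_def \<alpha>3_hat_def by blast
qed

text \<open>\<open>P x c a b\<close> is the derivative of \<open>R8 ^ 3 * \<omega>\<close> on
  \<open>(a, b)\<close> in direction \<open>c\<close>, computed from the polynomial form in
  \<open>R8_cubed_\<omega>\<close>.\<close>

lemma \<phi>_eq:
  defines "P \<equiv> \<lambda>x c a b. 8 * R8 x * (x \<bullet> c) * (Y1 a \<bullet> b)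
     - 4 * (x \<bullet> c) * ((x \<bullet> a) * \<alpha>1 x b - (x \<bullet> b) * \<alpha>1 x a)
     - 2 * R8 x * ((c \<bullet> a) * \<alpha>1 x b + (x \<bullet> a) * (Y1 c \<bullet> b) - (c \<bullet> b) * \<alpha>1 x a - (x \<bullet> b) * (Y1 c \<bullet> a))
     + 6 * (x \<bullet> c) * (\<alpha>2 x a * \<alpha>3 x b - \<alpha>2 x b * \<alpha>3 x a)
     + 3 * R8 x * ((Y2 c \<bullet> a) * \<alpha>3 x b + \<alpha>2 x a * (Y3 c \<bullet> b)
                   - (Y2 c \<bullet> b) * \<alpha>3 x a - \<alpha>2 x b * (Y3 c \<bullet> a))"
  shows "3 * \<phi> x a b c = P x a b c - P x b a c + P x c a b"
proof -
  have "((\<lambda>y. 1/3 * R8 y ^ 3 * \<omega> y a b) has_derivative (\<lambda>c. 1/3 * P x c a b)) (at x)" for a b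
    unfolding R8_cubed_\<omega>
    by (auto simp: P_def fun_eq_iff field_simps power2_eq_square
        intro!: derivative_eq_intros has_derivative_inner_left)
  then have D: "d0 (\<lambda>y. 1/3 * R8 y ^ 3 * \<omega> y a b) x c = 1/3 * P x c a b" for a b c
    by (rule d0_eqI)
  then show ?thesis
    unfolding \<phi>_def d2_def D by simp
qed

text \<open>\<open>du\<close> and \<open>dv\<close> are the differentials of the norms of
  \<open>u\<close> and \<open>v\<close>. The three terms are wedge products: of \<open>du\<close>
  with \<open>dv\<close>, of \<open>dR\<close> with \<open>\<beta>\<close>, and the sum of
  \<open>du\<^sub>i\<close> with \<open>dv\<^sub>i\<close> over the coordinates.\<close>

definition \<sigma>_expl :: "R6 form2" where
  "\<sigma>_expl m W Y = (let u = fst m; v = snd m; R = norm u + norm v;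
       du = (\<lambda>W. u \<bullet> fst W / norm u); dv = (\<lambda>W. v \<bullet> snd W / norm v);
       \<beta> = (\<lambda>W. u \<bullet> snd W - v \<bullet> fst W)
     in - R / 2 * (du W * dv Y - dv W * du Y) + ((du W + dv W) * \<beta> Y - (du Y + dv Y) * \<beta> W) / 2
        + R * (fst W \<bullet> snd Y - fst Y \<bullet> snd W))"

lemma \<phi>_descends:
  assumes "fst (Q x) \<noteq> 0" "snd (Q x) \<noteq> 0"
  shows "\<phi> x (X x) a b = \<sigma>_expl (Q x) (dQ x a) (dQ x b)"
proof -
  define u where "u = fst (Q x)"
  define v where "v = snd (Q x)"
  define W where "W = dQ x a"
  define Y where "Y = dQ x b"
  \<comment> \<open>\<open>du\<close> and \<open>dv\<close> are the differentials of the squared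
    lengths \<open>r\<close> of \<open>z\<close> and \<open>s\<close> of \<open>w\<close>;
    \<open>p\<close> and \<open>q\<close> are the inner products with \<open>i z\<close> and
    \<open>i w\<close>.\<close>
  define du where "du a = 2 * (x$0 * a$0 + x$1 * a$1 + x$4 * a$4 + x$5 * a$5)" for a :: "real^8"
  define dv where "dv a = 2 * (x$2 * a$2 + x$3 * a$3 + x$6 * a$6 + x$7 * a$7)" for a :: "real^8"
  define p where "p a = x$0 * a$1 - x$1 * a$0 + x$4 * a$5 - x$5 * a$4" for a :: "real^8"
  define q where "q a = x$2 * a$3 - x$3 * a$2 + x$6 * a$7 - x$7 * a$6" for a :: "real^8"
  define r where "r = norm u"
  define s where "s = norm v"
  note uv = u_def v_def r_def s_def
  have nz: "r \<noteq> 0" "s \<noteq> 0" using assms by (simp_all add: uv)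
  have R: "R8 x = r + s" by (simp add: uv R8_eq)
  have du: "u \<bullet> fst (dQ x a) = r * du a" and dv: "v \<bullet> snd (dQ x a) = s * dv a" for a
    unfolding uv norm_Q unfolding du_def dv_def inner_3 dQ_eq dQ_poly_def Q_nth by algebra+
  have xX: "x \<bullet> X x = 0"
    unfolding inner_8 X_nth by algebra
  have x: "x \<bullet> a = (du a + dv a) / 2" for a
    unfolding inner_8 du_def dv_def by simp
  have Xa: "X x \<bullet> a = p a + q a" "a \<bullet> X x = p a + q a" for a
    unfolding inner_8 X_nth p_def q_def by algebra+
  have \<alpha>1: "\<alpha>1 x a = p a - q a" for a
    unfolding \<alpha>1_def inner_8 Y_nth p_def q_def by algebra
  have \<alpha>1X: "\<alpha>1 x (X x) = r - s"
    unfolding uv norm_Q \<alpha>1_def inner_8 X_nth Y_nth by algebra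
  have Y1X: "Y1 (X x) \<bullet> a = (dv a - du a) / 2" for a
    unfolding inner_8 Y_nth X_nth du_def dv_def by simp
  have Y1X': "Y1 a \<bullet> X x = (du a - dv a) / 2" for a
    unfolding inner_8 Y_nth X_nth du_def dv_def by simp
  define \<beta> where "\<beta> b = \<alpha>2 x (X x) * \<alpha>3 x b - \<alpha>2 x b * \<alpha>3 x (X x)" for b
  have \<beta>: "2 * \<beta> b = s * du b - r * dv b - u \<bullet> snd (dQ x b) + v \<bullet> fst (dQ x b)" for b
    unfolding \<beta>_def uv norm_Q
    unfolding \<alpha>2_def \<alpha>3_def inner_8 Y_nth X_nth du_def dv_def inner_3 dQ_eq dQ_poly_def Q_nth
    by algebra
  \<comment> \<open>\<open>E\<close> and \<open>F\<close> are derivatives of the wedge product of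
    \<open>\<alpha>2\<close> and \<open>\<alpha>3\<close>, in direction \<open>X x\<close> and in
    direction \<open>a\<close>. The combination in \<open>EF\<close> is the contraction of its
    exterior derivative with \<open>X\<close>.\<close>
  define E where "E = (Y2 (X x) \<bullet> a) * \<alpha>3 x b + \<alpha>2 x a * (Y3 (X x) \<bullet> b)
      - (Y2 (X x) \<bullet> b) * \<alpha>3 x a - \<alpha>2 x b * (Y3 (X x) \<bullet> a)"
  define F where "F a b = (Y2 a \<bullet> X x) * \<alpha>3 x b + \<alpha>2 x (X x) * (Y3 a \<bullet> b)
      - (Y2 a \<bullet> b) * \<alpha>3 x (X x) - \<alpha>2 x b * (Y3 a \<bullet> X x)" for a b
  have EF: "E - F a b + F b a = du a * dv b - dv a * du b + fst W \<bullet> snd Y - fst Y \<bullet> snd W"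
    unfolding E_def F_def W_def Y_def
    unfolding \<alpha>2_def \<alpha>3_def inner_8 Y_nth X_nth du_def dv_def inner_3 dQ_eq dQ_poly_def fst_conv snd_conv vector_3
    by algebra
  have "3 * \<phi> x (X x) a b =
     - 2 * (r + s) * ((p a + q a) * (p b - q b) + (du a + dv a) / 2 * ((dv b - du b) / 2)
          - (p b + q b) * (p a - q a) - (du b + dv b) / 2 * ((dv a - du a) / 2)) + 3 * (r + s) * E
     - (8 * (r + s) * ((du a + dv a) / 2) * ((dv b - du b) / 2)
        + 4 * ((du a + dv a) / 2) * ((du b + dv b) / 2) * (r - s)
        - 2 * (r + s) * ((p a + q a) * (p b - q b) - (a \<bullet> b) * (r - s) - (du b + dv b) / 2 * ((du a - dv a) / 2))
        + 6 * ((du a + dv a) / 2) * \<beta> b + 3 * (r + s) * F a b)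
     + (8 * (r + s) * ((du b + dv b) / 2) * ((dv a - du a) / 2)
        + 4 * ((du b + dv b) / 2) * ((du a + dv a) / 2) * (r - s)
        - 2 * (r + s) * ((p b + q b) * (p a - q a) - (a \<bullet> b) * (r - s) - (du a + dv a) / 2 * ((du b - dv b) / 2))
        + 6 * ((du b + dv b) / 2) * \<beta> a + 3 * (r + s) * F b a)"
    unfolding \<phi>_eq xX \<alpha>1X Y1X Y1X' R E_def F_def \<beta>_def inner_commute[of b a]
    unfolding x Xa \<alpha>1 by algebra
  \<comment> \<open>All terms in \<open>p\<close>, \<open>q\<close> and \<open>a \<bullet> b\<close>
    cancel, which is why the result depends on \<open>dQ x a\<close> and \<open>dQ x b\<close>
    alone.\<close>
  also have "\<dots> = 3 * (r + s) * (E - F a b + F b a)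
     - 3 / 2 * (du a + dv a) * (2 * \<beta> b) + 3 / 2 * (du b + dv b) * (2 * \<beta> a)
     - 6 * (r + s) * (du a * dv b - dv a * du b)"
    by (simp add: field_simps)
  also have "\<dots> = 3 * \<sigma>_expl (Q x) W Y"
    unfolding EF \<beta> \<sigma>_expl_def Let_def u_def[symmetric] v_def[symmetric] W_def Y_def du dv
      r_def[symmetric] s_def[symmetric]
    using nz by (simp add: field_simps)
  finally show ?thesis
    by (simp add: W_def Y_def)
qed

section \<open>The almost complex structure\<close>

lemma bilinear_g_expl: "bilinear (g_expl m)"
  unfolding bilinear_def g_expl_def Let_def
  by (intro conjI allI linearI)
    (simp_all add: inner_add_left inner_add_right inner_diff_left inner_diff_right
      scaleR_add_right add_divide_distrib diff_divide_distrib algebra_simps)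

lemma bilinear_\<sigma>_expl: "bilinear (\<sigma>_expl m)"
  unfolding bilinear_def \<sigma>_expl_def Let_def
  by (intro conjI allI linearI)
    (simp_all add: inner_add_left inner_add_right add_divide_distrib diff_divide_distrib algebra_simps)

text \<open>Existence is \<open>h2_descends\<close>. For uniqueness, the fibre over \<open>m\<close>
  is nonempty by \<open>Q_surj\<close>, and at any of its points \<open>dQ x\<close> is onto, so all
  values of a candidate are determined.\<close>

lemma g2_eq:
  assumes "fst m \<noteq> 0" "snd m \<noteq> 0"
  shows "g2 m = g_expl m"
proof -
  obtain x where x: "Q x = m" by (rule Q_surj)
  show ?thesis
    unfolding g2_def
  proof (rule the_equality)
    show "\<forall>x. Q x = m \<longrightarrow> (\<forall>a b. h2 x a b =
        g_expl m (dQ x a) (dQ x b) + 1/4 * N x * (\<Theta>2 x a * \<Theta>2 x b))"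
      using h2_descends assms by blast
  next
    fix g assume "\<forall>x. Q x = m \<longrightarrow> (\<forall>a b. h2 x a b =
        g (dQ x a) (dQ x b) + 1/4 * N x * (\<Theta>2 x a * \<Theta>2 x b))"
    then have *: "g (dQ x a) (dQ x b) = g_expl m (dQ x a) (dQ x b)" for a b
      using h2_descends[of x a b] assms x by auto
    show "g = g_expl m"
    proof (intro ext)
      fix W Y
      obtain a b where "dQ x a = W" "dQ x b = Y"
        using dQ_surj[of x] assms x by metis
      then show "g W Y = g_expl m W Y" using * by blast
    qed
  qed
qed

lemma \<sigma>_eq:
  assumes "fst m \<noteq> 0" "snd m \<noteq> 0"
  shows "\<sigma> m = \<sigma>_expl m"
proof -
  obtain x where x: "Q x = m" by (rule Q_surj)
  show ?thesis
    unfolding \<sigma>_def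
  proof (rule the_equality)
    show "\<forall>x. Q x = m \<longrightarrow> (\<forall>a b. \<phi> x (X x) a b = \<sigma>_expl m (dQ x a) (dQ x b))"
      using \<phi>_descends assms by blast
  next
    fix s assume "\<forall>x. Q x = m \<longrightarrow> (\<forall>a b. \<phi> x (X x) a b = s (dQ x a) (dQ x b))"
    then have *: "s (dQ x a) (dQ x b) = \<sigma>_expl m (dQ x a) (dQ x b)" for a b
      using \<phi>_descends[of x a b] assms x by auto
    show "s = \<sigma>_expl m"
    proof (intro ext)
      fix W Y
      obtain a b where "dQ x a = W" "dQ x b = Y"
        using dQ_surj[of x] assms x by metis
      then show "s W Y = \<sigma>_expl m W Y" using * by blast
    qed
  qed
qed

text \<open>Write both forms through the inner product as \<open>g W Y = A W \<bullet> Y\<close> and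
  \<open>s W Y = B W \<bullet> Y\<close>. Positivity makes \<open>A\<close> injective, hence
  invertible in finite dimension, and \<open>J\<close> is the inverse of \<open>A\<close> after
  \<open>B / c\<close>.\<close>

lemma bilinear_form_representation:
  fixes g s :: "'a::euclidean_space \<Rightarrow> 'a \<Rightarrow> real"
  assumes g: "bilinear g" and s: "bilinear s"
    and pos: "\<And>W. W \<noteq> 0 \<Longrightarrow> g W W > 0" and c: "c \<noteq> 0"
  shows "\<exists>!J. linear J \<and> (\<forall>W Y. s W Y = c * g (J W) Y)"
proof -
  have rep: "(\<Sum>b\<in>Basis. f W b *\<^sub>R b) \<bullet> Y = f W Y" if f: "bilinear f" for f :: "'a \<Rightarrow> 'a \<Rightarrow> real" and W Y
  proof -
    have "f W Y = f W (\<Sum>b\<in>Basis. (Y \<bullet> b) *\<^sub>R b)"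
      by (simp add: euclidean_representation)
    also have "\<dots> = (\<Sum>b\<in>Basis. (Y \<bullet> b) * f W b)"
      using f by (simp add: bilinear_def linear_sum linear_cmul o_def)
    finally show ?thesis
      by (simp add: inner_sum_left inner_commute[of Y] mult.commute)
  qed
  have lin: "linear (\<lambda>W. \<Sum>b\<in>Basis. f W b *\<^sub>R b)" if f: "bilinear f" for f :: "'a \<Rightarrow> 'a \<Rightarrow> real"
    by (intro linear_compose_sum ballI linearI)
      (simp_all add: bilinear_ladd[OF f] bilinear_lmul[OF f] scaleR_add_left)
  define A where "A W = (\<Sum>b\<in>Basis. g W b *\<^sub>R b)" for W
  define B where "B W = (\<Sum>b\<in>Basis. s W b *\<^sub>R b)" for W
  have A: "linear A" and B: "linear B"
    unfolding A_def[abs_def] B_def[abs_def] using g s by (auto intro: lin)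
  have "W = 0" if "A W = 0" for W
    using rep[OF g, of W W] pos[of W] that by (force simp: A_def)
  then have inj: "inj A"
    using A linear_injective_0 by blast
  then have "surj A"
    using A linear_injective_imp_surjective by blast
  then obtain A' where A': "linear A'" "A \<circ> A' = id"
    using A linear_surjective_right_inverse by blast
  define J where "J = (\<lambda>W. A' ((1 / c) *\<^sub>R B W))"
  have "linear J"
    unfolding J_def using linear_compose[OF linear_compose_scale_right[OF B] A'(1)] by (simp add: o_def)
  moreover have "s W Y = c * g (J W) Y" for W Y
  proof -
    have "g (J W) Y = A (J W) \<bullet> Y"
      unfolding A_def rep[OF g] ..
    also have "\<dots> = s W Y / c"
      using A'(2) rep[OF s, of W Y] by (simp add: J_def B_def o_def fun_eq_iff)
    finally show ?thesis using c by simp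
  qed
  ultimately show ?thesis
  proof (intro ex1I[of _ J] conjI allI)
    fix J' assume J': "linear J' \<and> (\<forall>W Y. s W Y = c * g (J' W) Y)"
    show "J' = J"
    proof
      fix W
      have "g (J' W) Y = g (J W) Y" for Y
        using J' \<open>\<And>W Y. s W Y = c * g (J W) Y\<close> c by (metis mult_left_cancel)
      then have "A (J' W) = A (J W)"
        unfolding A_def by simp
      then show "J' W = J W" using inj by (simp add: inj_eq)
    qed
  qed auto
qed

section \<open>The orthogonal splitting along the submanifold\<close>

definition perp :: "real^3 \<Rightarrow> R6 set" where
  "perp n = {m. fst m \<bullet> n = 0 \<and> snd m \<bullet> n = 0}"

lemma det_coplanar:
  assumes "norm n = 1" "u \<bullet> n = 0" "v \<bullet> n = 0" "w \<bullet> n = 0"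
  shows "cross3 u v \<bullet> w = 0"
proof -
  \<comment> \<open>Cramer's rule: the expansion of \<open>n\<close> in the basis dual to
    \<open>u\<close>, \<open>v\<close>, \<open>w\<close>, multiplied by their determinant.\<close>
  have "(cross3 u v \<bullet> w) *\<^sub>R n = (u \<bullet> n) *\<^sub>R cross3 v w + (v \<bullet> n) *\<^sub>R cross3 w u + (w \<bullet> n) *\<^sub>R cross3 u v"
    unfolding vec_eq_3 inner_3[of "cross3 u v"] vector_add_component vector_scaleR_component
    unfolding inner_3 cross3_def vector_3 real_scaleR_def by (intro conjI; algebra)
  then show ?thesis using assms by auto
qed

text \<open>The triple product with the normal vector can be nonzero, but in \<open>g_expl\<close>
  it is multiplied by the one with \<open>W\<close>, which vanishes by coplanarity. Every other term
  contains a vanishing inner product with \<open>n\<close>.\<close>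

lemma g_expl_perp:
  assumes "norm n = 1" "m \<in> perp n" "W \<in> perp n"
  shows "g_expl m W (s *\<^sub>R n, t *\<^sub>R n) = 0"
proof -
  have "cross3 (fst m) (snd m) \<bullet> fst W = 0" "cross3 (fst m) (snd m) \<bullet> snd W = 0"
    using assms by (auto simp: perp_def intro: det_coplanar)
  then show ?thesis
    using assms by (simp add: g_expl_def Let_def perp_def inner_diff_left inner_diff_right)
qed

lemma \<sigma>_expl_perp:
  assumes "m \<in> perp n" "W \<in> perp n"
  shows "\<sigma>_expl m W (s *\<^sub>R n, t *\<^sub>R n) = 0"
  using assms by (simp add: \<sigma>_expl_def Let_def perp_def inner_commute[of n])

lemma \<J>_perp:
  assumes n: "norm n = 1" and m: "m \<in> perp n" "fst m \<noteq> 0" "snd m \<noteq> 0" and W: "W \<in> perp n"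
  shows "\<J> m W \<in> perp n"
proof -
  obtain x where x: "Q x = m" by (rule Q_surj)
  define c where "c = N_quot m powr (1/2)"
  have c: "c \<noteq> 0"
    using N_quot_pos[of "fst m" "snd m"] m by (simp add: c_def)
  have pos: "g_expl m W W > 0" if "W \<noteq> 0" for W
    using g_expl_pos[of x W] m x that by auto
  define J where "J = \<J> m"
  \<comment> \<open>Unique existence is what allows the defining property to be read off from the
    \<open>THE\<close> in \<open>\<J>\<close>.\<close>
  have "\<exists>!J. linear J \<and> (\<forall>W Y. \<sigma> m W Y = c * g2 m (J W) Y)"
    unfolding g2_eq[OF m(2,3)] \<sigma>_eq[OF m(2,3)]
    using bilinear_form_representation[OF bilinear_g_expl bilinear_\<sigma>_expl pos c] .
  from theI'[OF this] have J: "\<sigma>_expl m W Y = c * g_expl m (J W) Y" for W Y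
    unfolding J_def \<J>_def c_def[symmetric] g2_eq[OF m(2,3)] \<sigma>_eq[OF m(2,3)] by blast
  \<comment> \<open>\<open>k\<close> is the normal part of \<open>J W\<close>. Both
    \<open>J W - k\<close> and \<open>J W\<close> turn out to be \<open>g_expl\<close>-orthogonal to
    it, the latter because \<open>\<sigma>_expl\<close> vanishes on \<open>(W, k)\<close>.\<close>
  define k where "k = ((fst (J W) \<bullet> n) *\<^sub>R n, (snd (J W) \<bullet> n) *\<^sub>R n)"
  have nn: "n \<bullet> n = 1" using n by (simp add: norm_eq_1)
  have "J W - k \<in> perp n"
    by (simp add: perp_def k_def inner_diff_left nn)
  then have "g_expl m (J W - k) k = 0"
    unfolding k_def using g_expl_perp n m by blast
  moreover have "g_expl m (J W) k = 0"
    using J[of W k] \<sigma>_expl_perp[OF m(1) W] c by (simp add: k_def)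
  ultimately have "g_expl m k k = 0"
    using bilinear_lsub[OF bilinear_g_expl, of m "J W" k k] by simp
  then have "k = 0" using pos[of k] by (cases "k = 0") simp_all
  then have "fst (J W) \<bullet> n = 0" "snd (J W) \<bullet> n = 0"
    using n by (auto simp: k_def zero_prod_def)
  then show ?thesis by (simp add: perp_def J_def)
qed

lemma subspace_perp: "subspace (perp n)"
  by (auto simp: subspace_def perp_def inner_add_left)

lemma dim_perp:
  assumes "n \<noteq> 0"
  shows "dim (perp n) = 4"
proof -
  have "perp n = {a. n \<bullet> a = 0} \<times> {a. n \<bullet> a = 0}"
    by (auto simp: perp_def inner_commute)
  moreover have "dim {a. n \<bullet> a = 0} = 2"
    using dim_hyperplane[OF assms] by simp
  ultimately show ?thesis
    by (simp add: dim_Times subspace_hyperplane)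
qed

section \<open>The submanifold and its tangent spaces\<close>

lemma Ck_on_const: "Ck_on k S (\<lambda>x. c)"
  by (induction k arbitrary: c) (auto simp: frechet_derivative_const)

lemma smooth_on_affine:
  assumes "linear h"
  shows "smooth_on S (\<lambda>x. c + h x)"
proof -
  have D: "((\<lambda>x. c + h x) has_derivative h) (at x)" for x
    using linear_imp_has_derivative[OF assms] by (auto intro!: derivative_eq_intros)
  then have "frechet_derivative (\<lambda>x. c + h x) (at x) = h" for x
    by (metis frechet_derivative_at)
  moreover have "continuous_on S (\<lambda>x. c + h x)"
    using assms by (intro continuous_intros linear_continuous_on) (simp add: linear_linear)
  ultimately have "Ck_on k S (\<lambda>x. c + h x)" for k
    using D by (cases k) (auto simp: differentiable_def Ck_on_const)
  then show ?thesis by (simp add: smooth_on_def)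
qed

lemma functional_vanishes_on_tangent_space:
  assumes "bounded_linear h" "\<And>p. p \<in> S \<Longrightarrow> h p = (0::real)" "w \<in> tangent_space S p"
  shows "h w = 0"
proof -
  obtain \<gamma> \<epsilon> where \<gamma>: "0 < (\<epsilon>::real)" "\<gamma> ` {-\<epsilon><..<\<epsilon>} \<subseteq> S" "(\<gamma> has_vector_derivative w) (at 0)"
    using assms(3) by (auto simp: tangent_space_def)
  have "((\<lambda>t. h (\<gamma> t)) has_vector_derivative h w) (at 0)"
    using \<gamma>(3) by (rule bounded_linear.has_vector_derivative[OF assms(1)])
  moreover have "((\<lambda>t. h (\<gamma> t)) has_vector_derivative 0) (at 0)"
    by (rule has_vector_derivative_transform_within_open[of "\<lambda>t. 0" _ _ "{-\<epsilon><..<\<epsilon>}"])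
      (use \<gamma> assms(2) in \<open>auto simp: image_subset_iff\<close>)
  ultimately show ?thesis by (rule vector_derivative_unique_at)
qed

text \<open>A short straight segment through \<open>p\<close> in direction \<open>w\<close> stays in
  \<open>U\<close> by openness and in \<open>L\<close> by linearity.\<close>

lemma tangent_space_open_Int_subspace:
  assumes "open U" "subspace L" "p \<in> U \<inter> L" "w \<in> L"
  shows "w \<in> tangent_space (U \<inter> L) p"
proof -
  have "open ((\<lambda>t::real. p + t *\<^sub>R w) -` U)"
    using assms(1) by (intro open_vimage continuous_intros)
  moreover have "0 \<in> (\<lambda>t::real. p + t *\<^sub>R w) -` U"
    using assms(3) by simp
  ultimately obtain \<epsilon> where "\<epsilon> > 0" and \<epsilon>: "ball 0 \<epsilon> \<subseteq> (\<lambda>t::real. p + t *\<^sub>R w) -` U"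
    by (rule openE)
  have "smooth_on {-\<epsilon><..<\<epsilon>} (\<lambda>t. p + t *\<^sub>R w)"
    by (rule smooth_on_affine) (auto intro!: linearI simp: scaleR_add_left)
  moreover have "(\<lambda>t. p + t *\<^sub>R w) ` {-\<epsilon><..<\<epsilon>} \<subseteq> U \<inter> L"
    using \<epsilon> assms(2-4) by (auto simp: subset_iff dist_real_def subspace_add subspace_scale)
  moreover have "((\<lambda>t. p + t *\<^sub>R w) has_vector_derivative w) (at 0)"
    by (auto intro!: derivative_eq_intros)
  ultimately show ?thesis
    unfolding tangent_space_def using \<open>\<epsilon> > 0\<close> by force
qed

lemma M_of_eq: "M_of n = {m. fst m \<noteq> 0 \<and> snd m \<noteq> 0} \<inter> perp n"
  by (auto simp: M_of_def \<M>_def perp_def)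

lemma open_nonzero: "open {m::R6. fst m \<noteq> 0 \<and> snd m \<noteq> 0}"
  by (intro open_Collect_conj open_Collect_neq continuous_intros)

theorem theorem7p10:
  fixes n :: "real^3"
  assumes "norm n = 1"
  shows "embedded_submanifold 4 (M_of n) \<and>
    (\<forall>m \<in> M_of n. \<J> m ` tangent_space (M_of n) m \<subseteq> tangent_space (M_of n) m)"
proof (intro conjI ballI subsetI)
  define U :: "R6 set" where "U = {m. fst m \<noteq> 0 \<and> snd m \<noteq> 0}"
  have U: "open U" "M_of n = U \<inter> perp n"
    unfolding U_def by (rule open_nonzero, rule M_of_eq)
  have id: "smooth_on U (\<lambda>x. x)"
    using smooth_on_affine[of "\<lambda>x. x" U 0] by (simp add: linear_id[unfolded id_def])
  have "n \<noteq> 0" using assms by auto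
  then show "embedded_submanifold 4 (M_of n)"
    unfolding embedded_submanifold_def
  proof (intro ballI)
    fix p assume "p \<in> M_of n"
    then show "\<exists>U V f g (L::R6 set). open U \<and> p \<in> U \<and> open V \<and> subspace L \<and> dim L = 4 \<and>
        homeomorphism U V f g \<and> smooth_on U f \<and> smooth_on V g \<and> f ` (M_of n \<inter> U) = V \<inter> L"
      \<comment> \<open>The identity of \<open>U\<close> is a slice chart, since the submanifold is
        \<open>U\<close> cut by the linear subspace \<open>perp n\<close>.\<close>
      using U id subspace_perp dim_perp[OF \<open>n \<noteq> 0\<close>]
      by (intro exI[of _ U] exI[of _ "\<lambda>x. x"] exI[of _ "perp n"])
        (auto simp: homeomorphism_def)
  qed
  fix m w assume m: "m \<in> M_of n" and "w \<in> \<J> m ` tangent_space (M_of n) m"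
  then obtain W where w: "w = \<J> m W" and W: "W \<in> tangent_space (M_of n) m"
    by blast
  \<comment> \<open>The two linear functionals defining \<open>perp n\<close> vanish on the
    submanifold, hence on its tangent vectors.\<close>
  have "fst W \<bullet> n = 0" "snd W \<bullet> n = 0"
    by (rule functional_vanishes_on_tangent_space[OF _ _ W];
        auto simp: M_of_eq perp_def intro!: bounded_linear_intros)+
  then have "w \<in> perp n"
    unfolding w using \<J>_perp[OF assms, of m W] m by (simp add: M_of_eq) (simp add: perp_def)
  then show "w \<in> tangent_space (M_of n) m"
    unfolding U(2) using tangent_space_open_Int_subspace[OF U(1) subspace_perp] m U(2) by simp
qed

end
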